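(* Let $K\subset\mathbb{R}^2$ be the Vicsek fractal and $K_n$ ($n=0,1,2,\dots$) its pre-fractals, with intrinsic metrics $d^K$ on $K$ and $d^K_n$ on $K_n$ (all as defined in the context). Then for all $a,b\in K$ and arbitrary sequences $a_n\in K_n$, $b_n\in K_n$ with $d^K(a_n,a)\to0$ and $d^K(b_n,b)\to0$, one has $$d^K_n(a_n,b_n)\to d^K(a,b)\quad\text{as } n\to\infty.$$
   Context: On the Euclidean plane $\mathbb{R}^2$ consider the contractions $F_1(x,y)=(\tfrac13x,\tfrac13y)$, $F_2(x,y)=(\tfrac13x+2,\tfrac13y)$, $F_3(x,y)=(\tfrac13x,\tfrac13y+2)$, $F_4(x,y)=(\tfrac13x-2,\tfrac13y)$, $F_5(x,y)=(\tfrac13x,\tfrac13y-2)$. The Vicsek fractal $K$ is the unique nonempty compact set with $K=\bigcup_{i=1}^5F_i(K)$. The pre-fractals are $K_0=\{(x,0):-3\le x\le3\}\cup\{(0,y):-3\le y\le3\}$ and $K_{n+1}=\bigcup_{i=1}^5F_i(K_n)$; one has $K_n\subset K$. The metrics $d^K$ and $d^K_n$ are the intrinsic metrics on $K$ and $K_n$: the infimum of Euclidean lengths of curves joining two points inside the set. *)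

theory Defs
  imports "HOL-Analysis.Analysis"
begin

section \<open>Length of curves and intrinsic distance\<close>

text \<open>The length is the supremum of the lengths of inscribed polygons, over all finite
  subdivisions of \<open>{0..1}\<close>; it may be infinite. Repeated subdivision points contribute 0.\<close>

definition curve_length :: "(real \<Rightarrow> 'a::metric_space) \<Rightarrow> ennreal" where
  "curve_length g =
     (SUP ts \<in> {ts. sorted ts \<and> set ts \<subseteq> {0..1}}.
        \<Sum>i<length ts - 1. ennreal (dist (g (ts ! i)) (g (ts ! Suc i))))"

text \<open>The value is \<open>\<infinity>\<close> if no curve of finite length inside \<open>S\<close> joins the two points.\<close>

definition intrinsic_dist :: "'a::metric_space set \<Rightarrow> 'a \<Rightarrow> 'a \<Rightarrow> ennreal" where
  "intrinsic_dist S p q =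
     (INF g \<in> {g. path g \<and> path_image g \<subseteq> S \<and> pathstart g = p \<and> pathfinish g = q}.
        curve_length g)"

section \<open>The Vicsek fractal and its pre-fractals\<close>

text \<open>The plane is \<^typ>\<open>real \<times> real\<close>, whose library metric is the Euclidean one.\<close>

definition vicsek_maps :: "(real \<times> real \<Rightarrow> real \<times> real) set" where
  "vicsek_maps =
     {\<lambda>(x, y). (1/3 * x, 1/3 * y),
      \<lambda>(x, y). (1/3 * x + 2, 1/3 * y),
      \<lambda>(x, y). (1/3 * x, 1/3 * y + 2),
      \<lambda>(x, y). (1/3 * x - 2, 1/3 * y),
      \<lambda>(x, y). (1/3 * x, 1/3 * y - 2)}"

definition vicsek :: "(real \<times> real) set" where
  "vicsek = (THE K. K \<noteq> {} \<and> compact K \<and> K = (\<Union>F\<in>vicsek_maps. F ` K))"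

fun previcsek :: "nat \<Rightarrow> (real \<times> real) set" where
  "previcsek 0 = {(x, 0) |x. -3 \<le> x \<and> x \<le> 3} \<union> {(0, y) |y. -3 \<le> y \<and> y \<le> 3}"
| "previcsek (Suc n) = (\<Union>F\<in>vicsek_maps. F ` previcsek n)"

subsection \<open>The description of \<^const>\<open>vicsek\<close> is proper\<close>

lemma dist_vicsek_maps:
  assumes "F \<in> vicsek_maps"
  shows "dist (F p) (F q) = dist p q / 3"
proof -
  have "F p - F q = (1/3) *\<^sub>R (p - q)"
    using assms by (cases p; cases q) (auto simp: vicsek_maps_def field_simps)
  then show ?thesis by (simp add: dist_norm)
qed

lemma vicsek_subset_aux:
  assumes K: "compact K" "K = (\<Union>F\<in>vicsek_maps. F ` K)"
    and L: "L \<noteq> {}" "compact L" "L = (\<Union>F\<in>vicsek_maps. F ` L)"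
  shows "K \<subseteq> L"
proof (cases "K = {}")
  case False
  have "continuous_on K (\<lambda>x. infdist x L)" by (intro continuous_intros)
  from continuous_attains_sup[OF K(1) False this]
  obtain x where x: "x \<in> K" "\<And>y. y \<in> K \<Longrightarrow> infdist y L \<le> infdist x L"
    by auto
  have "x \<in> (\<Union>F\<in>vicsek_maps. F ` K)" using x(1) K(2) by (rule back_subst)
  then obtain F y where F: "F \<in> vicsek_maps" "y \<in> K" "x = F y" by auto
  obtain z where z: "z \<in> L" "infdist y L = dist y z"
    using infdist_attains_inf[OF compact_imp_closed[OF L(2)] L(1)] by blast
  have "F z \<in> (\<Union>F\<in>vicsek_maps. F ` L)" using z(1) F(1) by auto
  then have "F z \<in> L" using L(3)[symmetric] by (rule back_subst)
  then have "infdist x L \<le> dist (F y) (F z)" using infdist_le F(3) by auto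
  also have "\<dots> = infdist y L / 3" using dist_vicsek_maps[OF F(1)] z(2) by simp
  also have "\<dots> \<le> infdist x L / 3" using x(2)[OF F(2)] by simp
  finally have "infdist x L = 0" using infdist_nonneg[of x L] by simp
  then have "infdist y L = 0" if "y \<in> K" for y
    using x(2)[OF that] infdist_nonneg[of y L] by simp
  then show ?thesis
    using in_closed_iff_infdist_zero[OF compact_imp_closed[OF L(2)] L(1)] by auto
qed simp

lemma vicsek_exists:
  "\<exists>K. K \<noteq> {} \<and> compact K \<and> K = (\<Union>F\<in>vicsek_maps. F ` K)"
proof -
  define H where "H X = (\<Union>F\<in>vicsek_maps. F ` X)" for X
  define Q :: "(real \<times> real) set" where "Q = {-3..3} \<times> {-3..3}"
  define X where "X n = (H ^^ n) Q" for n
  have fin: "finite vicsek_maps" by (simp add: vicsek_maps_def)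
  have X0: "X 0 = Q" and XSuc: "X (Suc n) = H (X n)" for n by (simp_all add: X_def)
  have Hmono: "A \<subseteq> B \<Longrightarrow> H A \<subseteq> H B" for A B unfolding H_def by blast
  have "H Q \<subseteq> Q" by (auto simp: H_def Q_def vicsek_maps_def)
  then have dec1: "X (Suc n) \<subseteq> X n" for n
  proof (induction n)
    case 0
    then show ?case by (simp add: X0 XSuc)
  next
    case (Suc n)
    from Hmono[OF Suc.IH[OF Suc.prems]] show ?case by (simp only: XSuc)
  qed
  have dec: "m \<le> n \<Longrightarrow> X n \<subseteq> X m" for m n
    using lift_Suc_antimono_le[of X m n] dec1 by simp
  have cont: "continuous_on S F" if "F \<in> vicsek_maps" for F S
    using that by (auto simp: vicsek_maps_def case_prod_unfold intro!: continuous_intros)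
  have comp: "compact (X n)" for n
  proof (induction n)
    case 0
    show ?case by (simp add: X0 Q_def compact_Times)
  next
    case (Suc n)
    then show ?case unfolding XSuc H_def
      by (intro compact_UN fin compact_continuous_image cont)
  qed
  have zero: "(0, 0) \<in> X n" for n
  proof (induction n)
    case 0
    show ?case by (simp add: X0 Q_def)
  next
    case (Suc n)
    have "(0, 0) \<in> (\<lambda>(x, y). (1/3 * x, 1/3 * y)) ` X n"
      using Suc by (force simp: image_iff)
    then show ?case by (auto simp: XSuc H_def vicsek_maps_def)
  qed
  define K where "K = (\<Inter>n. X n)"
  have "K \<subseteq> X n" for n by (auto simp: K_def)
  then have "H K \<subseteq> X (Suc n)" for n unfolding XSuc by (rule Hmono)
  then have "H K \<subseteq> K" unfolding K_def using dec1 by fast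
  moreover have "K \<subseteq> H K"
  proof
    fix x assume "x \<in> K"
    then have "x \<in> H (X n)" for n unfolding K_def XSuc[symmetric] by blast
    then have "\<forall>n. \<exists>F. F \<in> vicsek_maps \<and> x \<in> F ` X n" by (simp add: H_def Bex_def)
    then obtain f where f: "\<And>n. f n \<in> vicsek_maps" "\<And>n. x \<in> f n ` X n" by metis
    have "finite (range f)" using fin f(1) by (meson finite_subset image_subsetI)
    then obtain m where m: "infinite {n. f n = f m}"
      using pigeonhole_infinite[of UNIV f] by auto
    have "\<exists>y\<in>X n. f m y = x" for n
    proof -
      obtain k where k: "k > n" "f k = f m"
        using m unfolding infinite_nat_iff_unbounded by blast
      then show ?thesis using f(2)[of k] dec[of n k] by auto
    qed
    then obtain g where g: "\<And>n. g n \<in> X n" "\<And>n. f m (g n) = x" by metis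
    have "g n = g 0" for n
      using dist_vicsek_maps[OF f(1)[of m], of "g n" "g 0"] g(2) by simp
    then have "g 0 \<in> X n" for n using g(1) by metis
    then have "g 0 \<in> K" by (simp add: K_def)
    then show "x \<in> H K" using f(1)[of m] g(2)[of 0] unfolding H_def by blast
  qed
  moreover have "compact K" unfolding K_def
    by (intro compact_Inter) (auto intro: comp)
  moreover have "K \<noteq> {}" using zero by (auto simp: K_def)
  ultimately have "K \<noteq> {} \<and> compact K \<and> K = H K" by auto
  then show ?thesis unfolding H_def by (rule exI)
qed

lemma vicsek_ex1:
  "\<exists>!K. K \<noteq> {} \<and> compact K \<and> K = (\<Union>F\<in>vicsek_maps. F ` K)"
proof (rule ex_ex1I[OF vicsek_exists])
  fix K L
  assume K: "K \<noteq> {} \<and> compact K \<and> K = (\<Union>F\<in>vicsek_maps. F ` K)"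
    and L: "L \<noteq> {} \<and> compact L \<and> L = (\<Union>F\<in>vicsek_maps. F ` L)"
  note K = K[THEN conjunct1] K[THEN conjunct2, THEN conjunct1] K[THEN conjunct2, THEN conjunct2]
  note L = L[THEN conjunct1] L[THEN conjunct2, THEN conjunct1] L[THEN conjunct2, THEN conjunct2]
  show "K = L"
    using vicsek_subset_aux[OF K(2,3) L] vicsek_subset_aux[OF L(2,3) K] by (rule equalityI)
qed

lemma vicsek_nonempty: "vicsek \<noteq> {}"
  and vicsek_compact: "compact vicsek"
  and vicsek_fixpoint: "vicsek = (\<Union>F\<in>vicsek_maps. F ` vicsek)"
  subgoal using theI'[OF vicsek_ex1, folded vicsek_def] by (rule conjunct1)
  subgoal using theI'[OF vicsek_ex1, folded vicsek_def, THEN conjunct2] by (rule conjunct1)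
  subgoal using theI'[OF vicsek_ex1, folded vicsek_def, THEN conjunct2] by (rule conjunct2)
  done

end

theory Submission
  imports Defs
begin

text \<open>Each pre-fractal \<open>previcsek n\<close> is a retract of \<^const>\<open>vicsek\<close> by a map that collapses every
  branch hanging off \<open>previcsek n\<close> to its base point. This retraction does not increase the length
  of curves: on each of finitely many closed pieces it is an orthogonal projection, hence
  1-Lipschitz, and two pieces meet in at most one point, which every curve passing between them
  must visit. Hence the intrinsic metrics of \<open>previcsek n\<close> and of \<^const>\<open>vicsek\<close> agree on
  \<open>previcsek n\<close>, and the convergence is the continuity of the latter metric.\<close>

section \<open>Polygons and the length of curves\<close>

fun polygon_length :: "'a::metric_space list \<Rightarrow> real" where
  "polygon_length (x # y # xs) = dist x y + polygon_length (y # xs)"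
| "polygon_length _ = 0"

lemma polygon_length_nonneg: "0 \<le> polygon_length xs"
  by (induction xs rule: polygon_length.induct) auto

lemma polygon_length_eq_sum:
  "polygon_length xs = (\<Sum>i<length xs - 1. dist (xs ! i) (xs ! Suc i))"
proof (induction xs rule: polygon_length.induct)
  case (1 x y xs)
  then show ?case by (simp add: sum.lessThan_Suc_shift del: sum.lessThan_Suc)
qed auto

lemma polygon_length_append_ge:
  "polygon_length xs + polygon_length ys \<le> polygon_length (xs @ ys)"
proof (induction xs rule: polygon_length.induct)
  case ("2_2" v)
  then show ?case by (cases ys) auto
qed auto

text \<open>By the triangle inequality, a detour through \<open>m\<close> at the seam only lengthens
  the polygon. This allows a polygon on a joined curve to be cut at the joint.\<close>

lemma polygon_length_append_le:
  "polygon_length (xs @ ys) \<le> polygon_length (xs @ [m]) + polygon_length (m # ys)"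
proof (induction xs rule: polygon_length.induct)
  case "2_1"
  then show ?case by (cases ys) auto
next
  case ("2_2" v)
  then show ?case by (cases ys) (auto simp: dist_triangle)
qed auto

lemma polygon_length_append_common:
  "polygon_length (xs @ y # ys) = polygon_length (xs @ [y]) + polygon_length (y # ys)"
  by (induction xs rule: polygon_length.induct) auto

lemma polygon_length_rev: "polygon_length (rev xs) = polygon_length xs"
proof (induction xs rule: polygon_length.induct)
  case (1 x y xs)
  then show ?case
    using polygon_length_append_common[of "rev xs" y "[x]"] by (simp add: dist_commute)
qed auto

lemma polygon_length_scale:
  fixes f :: "'a::metric_space \<Rightarrow> 'b::metric_space"
  assumes "\<And>x y. dist (f x) (f y) = c * dist x y"
  shows "polygon_length (map f xs) = c * polygon_length xs"
  by (induction xs rule: polygon_length.induct) (auto simp: assms algebra_simps)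

lemma curve_length_eq_SUP_polygon:
  "curve_length g = (SUP ts \<in> {ts. sorted ts \<and> set ts \<subseteq> {0..1}}. ennreal (polygon_length (map g ts)))"
proof -
  have "(\<Sum>i<length ts - 1. ennreal (dist (g (ts ! i)) (g (ts ! Suc i))))
      = ennreal (polygon_length (map g ts))" for ts
    by (subst sum_ennreal) (auto simp: polygon_length_eq_sum intro!: arg_cong[where f=ennreal] sum.cong)
  then show ?thesis by (simp add: curve_length_def)
qed

lemma polygon_le_curve_length:
  assumes "sorted ts" "set ts \<subseteq> {0..1}"
  shows "ennreal (polygon_length (map g ts)) \<le> curve_length g"
  unfolding curve_length_eq_SUP_polygon using assms by (intro SUP_upper) auto

lemma curve_length_le:
  assumes "\<And>ts. sorted ts \<Longrightarrow> set ts \<subseteq> {0..1} \<Longrightarrow> ennreal (polygon_length (map g ts)) \<le> L"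
  shows "curve_length g \<le> L"
  unfolding curve_length_eq_SUP_polygon using assms by (intro SUP_least) auto

lemma curve_length_reversepath: "curve_length (reversepath g) \<le> curve_length g"
proof (rule curve_length_le)
  fix ts :: "real list" assume ts: "sorted ts" "set ts \<subseteq> {0..1}"
  let ?us = "rev (map (\<lambda>t. 1 - t) ts)"
  have "sorted ?us"
    using ts(1) by (auto simp: sorted_wrt_rev sorted_wrt_map elim!: sorted_wrt_mono_rel[rotated])
  moreover have "set ?us \<subseteq> {0..1}" using ts(2) by auto
  moreover have "polygon_length (map (reversepath g) ts) = polygon_length (map g ?us)"
    by (simp add: rev_map[symmetric] polygon_length_rev reversepath_def comp_def)
  ultimately show "ennreal (polygon_length (map (reversepath g) ts)) \<le> curve_length g"
    using polygon_le_curve_length[of ?us g] by simp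
qed

text \<open>A subdivision of the joined curve is cut at time \<open>1/2\<close>. Adding the joint to
  both halves does not shorten the polygon, and each half rescales to a subdivision for
  \<open>g\<close> or for \<open>h\<close>.\<close>

lemma curve_length_joinpaths:
  assumes "pathfinish g = pathstart h"
  shows "curve_length (g +++ h) \<le> curve_length g + curve_length h"
proof (rule curve_length_le)
  fix ts :: "real list" assume ts: "sorted ts" "set ts \<subseteq> {0..1}"
  define xs where "xs = takeWhile (\<lambda>t. t \<le> 1/2) ts"
  define ys where "ys = dropWhile (\<lambda>t. t \<le> 1/2) ts"
  have tseq: "ts = xs @ ys" by (simp add: xs_def ys_def)
  have xs: "t \<le> 1/2" if "t \<in> set xs" for t using that set_takeWhileD by (force simp: xs_def)
  have ys: "1/2 < t" if "t \<in> set ys" for t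
  proof (cases ys)
    case (Cons y zs)
    then have "y > 1/2" using hd_dropWhile[of "\<lambda>t. t \<le> 1/2" ts] by (auto simp: ys_def)
    moreover have "sorted (y # zs)" using ts(1) tseq Cons by (auto simp: sorted_append)
    ultimately show ?thesis using that Cons by auto
  qed (use that in auto)
  \<comment> \<open>\<open>1/2\<close> becomes the last time of the first half and the first time of
    the second. The affine maps undo the reparametrisation in \<open>+++\<close>.\<close>
  let ?us = "map (\<lambda>t. 2 * t) (xs @ [1/2])" and ?vs = "map (\<lambda>t. 2 * t - 1) (1/2 # ys)"
  have srt: "sorted xs" "sorted ys" using ts(1) tseq by (auto simp: sorted_append)
  have us: "sorted ?us" "set ?us \<subseteq> {0..1}"
    using srt(1) xs ts(2) tseq
    by (force simp: sorted_append sorted_wrt_map elim!: sorted_wrt_mono_rel[rotated])+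
  have vs: "sorted ?vs" "set ?vs \<subseteq> {0..1}"
    using srt(2) ys ts(2) tseq
    by (force simp: sorted_wrt_map elim!: sorted_wrt_mono_rel[rotated])+
  have "map (g +++ h) (xs @ [1/2]) = map g ?us" using xs by (auto simp: joinpaths_def)
  moreover have "map (g +++ h) (1/2 # ys) = map h ?vs"
    using ys assms by (fastforce simp: joinpaths_def pathfinish_def pathstart_def)
  moreover have "polygon_length (map (g +++ h) ts)
      \<le> polygon_length (map (g +++ h) (xs @ [1/2])) + polygon_length (map (g +++ h) (1/2 # ys))"
    using polygon_length_append_le[of "map (g +++ h) xs" "map (g +++ h) ys" "(g +++ h) (1/2)"]
    by (simp add: tseq)
  ultimately have "polygon_length (map (g +++ h) ts) \<le> polygon_length (map g ?us) + polygon_length (map h ?vs)"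
    by (simp only:)
  then have "ennreal (polygon_length (map (g +++ h) ts))
      \<le> ennreal (polygon_length (map g ?us)) + ennreal (polygon_length (map h ?vs))"
    by (simp add: polygon_length_nonneg flip: ennreal_plus)
  also have "\<dots> \<le> curve_length g + curve_length h"
    by (intro add_mono polygon_le_curve_length us vs)
  finally show "ennreal (polygon_length (map (g +++ h) ts)) \<le> curve_length g + curve_length h" .
qed

section \<open>The intrinsic distance\<close>

lemma intrinsic_dist_le:
  assumes "path g" "path_image g \<subseteq> S" "pathstart g = p" "pathfinish g = q"
  shows "intrinsic_dist S p q \<le> curve_length g"
  unfolding intrinsic_dist_def using assms by (intro INF_lower) auto

lemma intrinsic_dist_greatest:
  assumes "\<And>g. path g \<Longrightarrow> path_image g \<subseteq> S \<Longrightarrow> pathstart g = p \<Longrightarrow> pathfinish g = q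
    \<Longrightarrow> L \<le> curve_length g"
  shows "L \<le> intrinsic_dist S p q"
  unfolding intrinsic_dist_def using assms by (intro INF_greatest) auto

lemma intrinsic_dist_antimono: "S \<subseteq> T \<Longrightarrow> intrinsic_dist T p q \<le> intrinsic_dist S p q"
  by (intro intrinsic_dist_greatest intrinsic_dist_le) auto

lemma intrinsic_dist_commute:
  fixes p q :: "'a::real_normed_vector"
  shows "intrinsic_dist S p q = intrinsic_dist S q p"
proof -
  have "intrinsic_dist S p q \<le> intrinsic_dist S q p" for p q :: 'a
  proof (rule intrinsic_dist_greatest)
    fix g assume g: "path g" "path_image g \<subseteq> S" "pathstart g = q" "pathfinish g = p"
    have "intrinsic_dist S p q \<le> curve_length (reversepath g)"
      by (rule intrinsic_dist_le) (use g in auto)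
    then show "intrinsic_dist S p q \<le> curve_length g"
      using curve_length_reversepath order_trans by blast
  qed
  then show ?thesis by (intro antisym)
qed

section \<open>The triangle inequality for the intrinsic distance\<close>

lemma INF_add_const_ennreal:
  fixes f :: "'i \<Rightarrow> ennreal"
  assumes "I \<noteq> {}"
  shows "(INF i\<in>I. f i + c) = (INF i\<in>I. f i) + c"
proof -
  \<comment> \<open>A monotone map that is continuous from the right at an infimum commutes with
    it.\<close>
  have "continuous (at_right (INF i\<in>I. f i)) (\<lambda>x. x + c)"
    by (intro continuous_add continuous_ident continuous_const)
  then show ?thesis
    using assms continuous_at_Inf_mono[of "\<lambda>x. x + c" "f ` I"]
    by (simp add: mono_def image_comp comp_def)
qed

lemma INF_const_add_ennreal:
  fixes f :: "'i \<Rightarrow> ennreal"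
  assumes "I \<noteq> {}"
  shows "(INF i\<in>I. c + f i) = c + (INF i\<in>I. f i)"
  using INF_add_const_ennreal[OF assms, of f c] by (simp add: ac_simps)

lemma intrinsic_dist_triangle:
  fixes p q r :: "'a::real_normed_vector"
  shows "intrinsic_dist S p r \<le> intrinsic_dist S p q + intrinsic_dist S q r"
proof -
  let ?P = "\<lambda>p q. {g. path g \<and> path_image g \<subseteq> S \<and> pathstart g = p \<and> pathfinish g = q}"
  have *: "intrinsic_dist S p r \<le> curve_length g + curve_length h"
    if "g \<in> ?P p q" "h \<in> ?P q r" for g h
  proof -
    have "intrinsic_dist S p r \<le> curve_length (g +++ h)"
      using that by (intro intrinsic_dist_le) (auto simp: path_image_join)
    also have "\<dots> \<le> curve_length g + curve_length h"
      using that by (intro curve_length_joinpaths) auto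
    finally show ?thesis .
  qed
  show ?thesis
  \<comment> \<open>If one family of curves is empty, its infimum is \<open>top\<close> and the
    bound is trivial.\<close>
  proof (cases "?P p q = {} \<or> ?P q r = {}")
    case True
    then show ?thesis unfolding intrinsic_dist_def[of S p q] intrinsic_dist_def[of S q r]
      by (elim disjE) (simp_all add: top_add add_top del: Collect_empty_eq)
  next
    case False
    have "intrinsic_dist S p r \<le> (INF g \<in> ?P p q. INF h \<in> ?P q r. curve_length g + curve_length h)"
      by (intro INF_greatest *)
    also have "\<dots> = (INF g \<in> ?P p q. curve_length g + intrinsic_dist S q r)"
      using False unfolding intrinsic_dist_def by (simp only: INF_const_add_ennreal de_Morgan_disj not_False_eq_True simp_thms)
    also have "\<dots> = intrinsic_dist S p q + intrinsic_dist S q r"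
      using False unfolding intrinsic_dist_def[of S p q]
      by (simp only: INF_add_const_ennreal de_Morgan_disj not_False_eq_True)
    finally show ?thesis .
  qed
qed

section \<open>Maps that do not increase the length of curves\<close>

text \<open>Being 1-Lipschitz is too strong: points of different branches may be close in the plane
  but have distant images. So the displacement of \<open>f\<close> is compared with a polygon
  inscribed in a curve inside \<open>X\<close>. Such finite polygons can be concatenated, so no
  length over a subinterval has to be introduced.\<close>

definition length_contracting :: "'a::metric_space set \<Rightarrow> ('a \<Rightarrow> 'b::metric_space) \<Rightarrow> bool" where
  "length_contracting X f \<longleftrightarrow> continuous_on X f \<and>
     (\<forall>g s t. s \<le> (t::real) \<longrightarrow> continuous_on {s..t} g \<longrightarrow> g ` {s..t} \<subseteq> X \<longrightarrow>
        (\<exists>us. sorted us \<and> set us \<subseteq> {s..t} \<and> dist (f (g s)) (f (g t)) \<le> polygon_length (map g us)))"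

lemma length_contractingD:
  fixes s t :: real
  assumes "length_contracting X f" "s \<le> t" "continuous_on {s..t} g" "g ` {s..t} \<subseteq> X"
  obtains us where "sorted us" "set us \<subseteq> {s..t}"
    "dist (f (g s)) (f (g t)) \<le> polygon_length (map g us)"
  using assms unfolding length_contracting_def by blast

lemma length_contracting_continuous_on: "length_contracting X f \<Longrightarrow> continuous_on X f"
  by (simp add: length_contracting_def)

lemma length_contracting_cong:
  assumes "length_contracting X f" "\<And>x. x \<in> X \<Longrightarrow> f x = f' x"
  shows "length_contracting X f'"
  unfolding length_contracting_def
proof (intro conjI allI impI)
  show "continuous_on X f'"
    using assms continuous_on_cong[of X X f f'] by (auto simp: length_contracting_def)
next
  fix g and s t :: real
  assume *: "s \<le> t" "continuous_on {s..t} g" "g ` {s..t} \<subseteq> X"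
  then have "g s \<in> X" "g t \<in> X" by (auto simp: image_subset_iff)
  then have "f' (g s) = f (g s)" "f' (g t) = f (g t)" using assms(2) by auto
  then show "\<exists>us. sorted us \<and> set us \<subseteq> {s..t} \<and> dist (f' (g s)) (f' (g t)) \<le> polygon_length (map g us)"
    using length_contractingD[OF assms(1) *] by metis
qed

lemma length_contracting_1_Lipschitz:
  assumes "\<And>x y. x \<in> X \<Longrightarrow> y \<in> X \<Longrightarrow> dist (f x) (f y) \<le> dist x y"
  shows "length_contracting X f"
  unfolding length_contracting_def
proof (intro conjI allI impI)
  show "continuous_on X f"
    unfolding continuous_on_iff using assms by (meson le_less_trans)
next
  fix g and s t :: real
  assume "s \<le> t" "continuous_on {s..t} g" "g ` {s..t} \<subseteq> X"
  then show "\<exists>us. sorted us \<and> set us \<subseteq> {s..t} \<and> dist (f (g s)) (f (g t)) \<le> polygon_length (map g us)"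
    using assms[of "g s" "g t"] by (intro exI[of _ "[s, t]"]) (auto simp: image_subset_iff)
qed

lemma connected_subset_closed_Un:
  assumes "connected C" "closed A" "closed B" "C \<subseteq> A \<union> B" "A \<inter> B \<inter> C = {}"
  shows "C \<subseteq> A \<or> C \<subseteq> B"
  using assms connected_closed[of C] by blast

text \<open>A curve can change between \<open>A\<close> and \<open>B\<close> only at
  \<open>c\<close>. Up to its first visit to \<open>c\<close> and from its last visit on, it stays
  within one piece, where the hypothesis on that piece applies. Whatever happens between the two
  visits starts and ends at \<open>c\<close> and causes no displacement.\<close>

lemma length_contracting_Un:
  assumes A: "closed A" "length_contracting A f" and B: "closed B" "length_contracting B f"
    and AB: "A \<inter> B = {c}"
  shows "length_contracting (A \<union> B) f"
  unfolding length_contracting_def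
proof (intro conjI allI impI)
  show "continuous_on (A \<union> B) f"
    using A B by (intro continuous_on_closed_Un length_contracting_continuous_on)
next
  fix g and s t :: real
  assume st: "s \<le> t" and g: "continuous_on {s..t} g" and gX: "g ` {s..t} \<subseteq> A \<union> B"
  have piece: "\<exists>us. sorted us \<and> set us \<subseteq> {u..v} \<and> dist (f (g u)) (f (g v)) \<le> polygon_length (map g us)"
    if uv: "s \<le> u" "u \<le> v" "v \<le> t" and I: "g ` {u..v} \<subseteq> A \<or> g ` {u..v} \<subseteq> B" for u v
  proof -
    have "continuous_on {u..v} g" using g uv by (auto intro: continuous_on_subset)
    then show ?thesis using I A(2) B(2) uv(2) by (meson length_contractingD)
  qed
  have one_side: "g ` J \<subseteq> A \<or> g ` J \<subseteq> B"
    if J: "connected J" "J \<subseteq> {s..t}" "c \<notin> g ` J" for J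
  proof (rule connected_subset_closed_Un[OF _ A(1) B(1)])
    show "connected (g ` J)"
      using J g by (meson connected_continuous_image continuous_on_subset)
    show "g ` J \<subseteq> A \<union> B" using gX J by auto
    show "A \<inter> B \<inter> g ` J = {}" using AB J by auto
  qed
  define T where "T = {s..t} \<inter> g -` {c}"
  show "\<exists>us. sorted us \<and> set us \<subseteq> {s..t} \<and> dist (f (g s)) (f (g t)) \<le> polygon_length (map g us)"
  proof (cases "T = {}")
    case True
    then have "c \<notin> g ` {s..t}" by (auto simp: T_def)
    then show ?thesis using piece[of s t] one_side[of "{s..t}"] st by auto
  next
    case False
    have "closed T" unfolding T_def using g by (intro continuous_closed_preimage) auto
    moreover have "bounded T" by (rule bounded_subset[of "{s..t}"]) (auto simp: T_def)
    ultimately have "compact T" by (simp add: compact_eq_bounded_closed)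
    \<comment> \<open>Compactness of the set \<open>T\<close> of visiting times provides the first
      visit \<open>u\<close> and the last visit \<open>v\<close>.\<close>
    obtain u where u: "u \<in> T" "\<And>w. w \<in> T \<Longrightarrow> u \<le> w"
      using compact_attains_inf[OF \<open>compact T\<close> False] by blast
    obtain v where v: "v \<in> T" "\<And>w. w \<in> T \<Longrightarrow> w \<le> v"
      using compact_attains_sup[OF \<open>compact T\<close> False] by blast
    have uv: "s \<le> u" "u \<le> v" "v \<le> t" "g u = c" "g v = c" using u v by (auto simp: T_def)
    have cAB: "c \<in> A" "c \<in> B" using AB by auto
    \<comment> \<open>The half-open part avoids \<open>c\<close>, so by connectedness it lies in one
      piece; its end \<open>g u = c\<close> belongs to both pieces and can be added.\<close>
    have "g w \<noteq> c" if "w \<in> {s..<u}" for w using u(2)[of w] that uv by (auto simp: T_def)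
    then have "c \<notin> g ` {s..<u}" by blast
    then have "g ` {s..<u} \<subseteq> A \<or> g ` {s..<u} \<subseteq> B" using uv by (intro one_side) auto
    moreover have "{s..u} = insert u {s..<u}" using uv by auto
    ultimately have "g ` {s..u} \<subseteq> A \<or> g ` {s..u} \<subseteq> B" using uv cAB by auto
    then obtain us where us: "sorted us" "set us \<subseteq> {s..u}"
        "dist (f (g s)) (f (g u)) \<le> polygon_length (map g us)"
      using piece[of s u] uv by auto
    have "g w \<noteq> c" if "w \<in> {v<..t}" for w using v(2)[of w] that uv by (auto simp: T_def)
    then have "c \<notin> g ` {v<..t}" by blast
    then have "g ` {v<..t} \<subseteq> A \<or> g ` {v<..t} \<subseteq> B" using uv by (intro one_side) auto
    moreover have "{v..t} = insert v {v<..t}" using uv by auto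
    ultimately have "g ` {v..t} \<subseteq> A \<or> g ` {v..t} \<subseteq> B" using uv cAB by auto
    then obtain vs where vs: "sorted vs" "set vs \<subseteq> {v..t}"
        "dist (f (g v)) (f (g t)) \<le> polygon_length (map g vs)"
      using piece[of v t] uv by auto
    have "sorted (us @ vs)" using us vs uv by (force simp: sorted_append)
    moreover have "set (us @ vs) \<subseteq> {s..t}" using us vs uv by fastforce
    \<comment> \<open>Both \<open>f (g u)\<close> and \<open>f (g v)\<close> equal
      \<open>f c\<close>, so the middle part drops out.\<close>
    moreover have "dist (f (g s)) (f (g t)) \<le> dist (f (g s)) (f (g u)) + dist (f (g v)) (f (g t))"
      using uv dist_triangle by metis
    then have "dist (f (g s)) (f (g t)) \<le> polygon_length (map g (us @ vs))"
      using us(3) vs(3) polygon_length_append_ge[of "map g us" "map g vs"] by simp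
    ultimately show ?thesis by blast
  qed
qed

text \<open>Each edge of the image polygon is bounded by a polygon on \<open>g\<close> within the
  parameter interval of that edge. Confining the times to \<open>{a..1}\<close> keeps the
  concatenation sorted in the induction.\<close>

lemma length_contracting_polygon:
  assumes f: "length_contracting X f" and g: "path g" "path_image g \<subseteq> X"
    and ts: "sorted (a # ts)" "set (a # ts) \<subseteq> {0..1}"
  shows "\<exists>us. sorted us \<and> set us \<subseteq> {a..1} \<and> polygon_length (map (f \<circ> g) (a # ts)) \<le> polygon_length (map g us)"
  using ts
proof (induction ts arbitrary: a)
  case Nil
  then show ?case by (intro exI[of _ "[]"]) auto
next
  case (Cons b ts)
  then obtain vs where vs: "sorted vs" "set vs \<subseteq> {b..1}"
      "polygon_length (map (f \<circ> g) (b # ts)) \<le> polygon_length (map g vs)"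
    by (metis list.set_intros(2) set_subset_Cons sorted_wrt.simps(2) subset_trans)
  have ab: "0 \<le> a" "a \<le> b" "b \<le> 1" using Cons.prems by auto
  then have "continuous_on {a..b} g" "g ` {a..b} \<subseteq> X"
    using g by (auto simp: path_def path_image_def intro: continuous_on_subset)
  then obtain us where us: "sorted us" "set us \<subseteq> {a..b}"
      "dist (f (g a)) (f (g b)) \<le> polygon_length (map g us)"
    using length_contractingD[OF f ab(2)] by blast
  have "sorted (us @ vs)" using us vs by (force simp: sorted_append)
  moreover have "set (us @ vs) \<subseteq> {a..1}" using us vs ab by fastforce
  moreover have "polygon_length (map (f \<circ> g) (a # b # ts)) \<le> polygon_length (map g (us @ vs))"
    using us(3) vs(3) polygon_length_append_ge[of "map g us" "map g vs"] by simp
  ultimately show ?case by blast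
qed

lemma curve_length_length_contracting:
  assumes "length_contracting X f" "path g" "path_image g \<subseteq> X"
  shows "curve_length (f \<circ> g) \<le> curve_length g"
proof (rule curve_length_le)
  fix ts :: "real list" assume ts: "sorted ts" "set ts \<subseteq> {0..1}"
  show "ennreal (polygon_length (map (f \<circ> g) ts)) \<le> curve_length g"
  proof (cases ts)
    case (Cons a ts')
    then obtain us where us: "sorted us" "set us \<subseteq> {a..1}"
        "polygon_length (map (f \<circ> g) ts) \<le> polygon_length (map g us)"
      using length_contracting_polygon[OF assms, of a ts'] ts by auto
    have "set us \<subseteq> {0..1}" using us(2) ts(2) Cons by fastforce
    then show ?thesis
      using polygon_le_curve_length[OF us(1), of g] ennreal_leI[OF us(3)] by (auto intro: order_trans)
  qed auto
qed

text \<open>Composition with \<open>r\<close> sends a curve in \<open>X\<close> to one in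
  \<open>S\<close> that is no longer and, as \<open>r\<close> fixes \<open>p\<close> and
  \<open>q\<close>, has the same end points. The other inequality is monotonicity in the
  set.\<close>

lemma intrinsic_dist_retract:
  assumes r: "length_contracting X r" "r ` X \<subseteq> S" "S \<subseteq> X" "r p = p" "r q = q"
  shows "intrinsic_dist S p q = intrinsic_dist X p q"
proof (rule antisym)
  show "intrinsic_dist S p q \<le> intrinsic_dist X p q"
  proof (rule intrinsic_dist_greatest)
    fix g assume g: "path g" "path_image g \<subseteq> X" "pathstart g = p" "pathfinish g = q"
    have "continuous_on (path_image g) r"
      using length_contracting_continuous_on[OF r(1)] g(2) continuous_on_subset by blast
    then have "path (r \<circ> g)" using g(1) by (rule path_continuous_image[rotated])
    moreover have "path_image (r \<circ> g) \<subseteq> S" using g(2) r(2) by (auto simp: path_image_compose)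
    ultimately have "intrinsic_dist S p q \<le> curve_length (r \<circ> g)"
      using g(3,4) r(4,5) by (intro intrinsic_dist_le) (auto simp: pathstart_compose pathfinish_compose)
    also have "\<dots> \<le> curve_length g"
      using curve_length_length_contracting[OF r(1) g(1,2)] .
    finally show "intrinsic_dist S p q \<le> curve_length g" .
  qed
qed (rule intrinsic_dist_antimono[OF r(3)])

text \<open>A homothety multiplies displacements and polygon lengths by the same factor
  \<open>k\<close>, so the defining inequality passes to the scaled copy. It is used to copy a
  retraction into each cell.\<close>

lemma length_contracting_conjugate:
  fixes r :: "'a::real_normed_vector \<Rightarrow> 'a"
  assumes r: "length_contracting X r" and k: "k > 0"
    and F: "\<And>x. F x = k *\<^sub>R x + c" and f: "\<And>x. x \<in> X \<Longrightarrow> f (F x) = F (r x)"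
  shows "length_contracting (F ` X) f"
  unfolding length_contracting_def
proof (intro conjI allI impI)
  \<comment> \<open>\<open>G\<close> is the inverse homothety; it pulls the curve back to
    \<open>X\<close>.\<close>
  define G where "G y = (1/k) *\<^sub>R (y - c)" for y
  have GF: "G (F x) = x" and FG: "F (G x) = x" for x using k by (simp_all add: G_def F)
  have fG: "f y = F (r (G y))" and GX: "G y \<in> X" if "y \<in> F ` X" for y using that f GF by auto
  have dF: "dist (F x) (F y) = k * dist x y" for x y
    using k by (simp add: F dist_norm flip: scaleR_diff_right)
  have "continuous_on (F ` X) (\<lambda>y. F (r (G y)))"
  proof -
    have "continuous_on (F ` X) G" unfolding G_def by (intro continuous_intros)
    moreover have "G ` F ` X \<subseteq> X" using GX by blast
    ultimately have "continuous_on (F ` X) (\<lambda>y. r (G y))"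
      using continuous_on_compose2[OF length_contracting_continuous_on[OF r]] by blast
    then show ?thesis unfolding F by (intro continuous_intros)
  qed
  then show "continuous_on (F ` X) f"
    by (rule continuous_on_cong[THEN iffD1, rotated 2]) (simp_all only: fG)
  fix g and s t :: real
  assume st: "s \<le> t" and g: "continuous_on {s..t} g" "g ` {s..t} \<subseteq> F ` X"
  have "continuous_on {s..t} (\<lambda>x. G (g x))" unfolding G_def using g(1) by (intro continuous_intros)
  moreover have "(\<lambda>x. G (g x)) ` {s..t} \<subseteq> X" using g(2) GX by blast
  ultimately obtain us where us: "sorted us" "set us \<subseteq> {s..t}"
      "dist (r (G (g s))) (r (G (g t))) \<le> polygon_length (map (\<lambda>x. G (g x)) us)"
    by (rule length_contractingD[OF r st])
  have "g s \<in> F ` X" "g t \<in> F ` X" using g(2) st by (auto simp: image_subset_iff)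
  then have "dist (f (g s)) (f (g t)) = k * dist (r (G (g s))) (r (G (g t)))"
    by (simp add: fG dF)
  also have "\<dots> \<le> k * polygon_length (map (\<lambda>x. G (g x)) us)" using us(3) k by simp
  also have "\<dots> = polygon_length (map F (map (\<lambda>x. G (g x)) us))"
    by (rule polygon_length_scale[OF dF, symmetric])
  also have "\<dots> = polygon_length (map g us)" by (simp add: comp_def FG)
  finally show "\<exists>us. sorted us \<and> set us \<subseteq> {s..t} \<and> dist (f (g s)) (f (g t)) \<le> polygon_length (map g us)"
    using us by blast
qed

section \<open>Cells of the Vicsek fractal\<close>

text \<open>The images of the origin under the five contractions, which index the cells.\<close>

definition vicsek_centres :: "(real \<times> real) set" where
  "vicsek_centres = {(0, 0), (2, 0), (0, 2), (-2, 0), (0, -2)}"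

definition cell_map :: "real \<times> real \<Rightarrow> real \<times> real \<Rightarrow> real \<times> real" where
  "cell_map c p = (1/3) *\<^sub>R p + c"

lemma cell_map_Pair: "cell_map (u, v) (x, y) = (x / 3 + u, y / 3 + v)"
  by (simp add: cell_map_def)

lemma vicsek_maps_eq: "vicsek_maps = cell_map ` vicsek_centres"
proof -
  have "cell_map (u, v) = (\<lambda>(x, y). (1/3 * x + u, 1/3 * y + v))" for u v
    by (auto simp: cell_map_Pair)
  then show ?thesis by (simp add: vicsek_maps_def vicsek_centres_def)
qed

lemma vicsek_eq: "vicsek = (\<Union>c\<in>vicsek_centres. cell_map c ` vicsek)"
  using vicsek_fixpoint by (simp only: vicsek_maps_eq image_image)

lemma cell_map_in_vicsek: "c \<in> vicsek_centres \<Longrightarrow> p \<in> vicsek \<Longrightarrow> cell_map c p \<in> vicsek"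
  using vicsek_eq by blast

lemma vicsek_cases:
  assumes "p \<in> vicsek"
  obtains c q where "c \<in> vicsek_centres" "q \<in> vicsek" "p = cell_map c q"
  using assms vicsek_eq by blast

text \<open>At a point \<open>p\<close> where the 1-norm \<open>N\<close> is maximal,
  self-similarity gives \<open>N p \<le> N p / 3 + 2\<close>, hence
  \<open>N p \<le> 3\<close>.\<close>

lemma vicsek_subset_diamond:
  assumes "(x, y) \<in> vicsek"
  shows "\<bar>x\<bar> + \<bar>y\<bar> \<le> 3"
proof -
  define N :: "real \<times> real \<Rightarrow> real" where "N p = \<bar>fst p\<bar> + \<bar>snd p\<bar>" for p
  have "continuous_on vicsek N" unfolding N_def by (intro continuous_intros)
  then obtain p where p: "p \<in> vicsek" "\<And>q. q \<in> vicsek \<Longrightarrow> N q \<le> N p"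
    using continuous_attains_sup[OF vicsek_compact vicsek_nonempty] by blast
  obtain c q where cq: "c \<in> vicsek_centres" "q \<in> vicsek" "p = cell_map c q"
    using vicsek_cases[OF p(1)] .
  have "N p \<le> N q / 3 + 2"
    using cq(1,3) by (cases q; auto simp: N_def vicsek_centres_def cell_map_Pair add_divide_distrib abs_if)
  then have "N p \<le> 3" using p(2)[OF cq(2)] by simp
  then show ?thesis using p(2)[OF assms] by (simp add: N_def)
qed

text \<open>A point on a diagonal must lie in the central cell, so three times the point is again in
  the fractal and on a diagonal. Applied to a diagonal point with maximal first coordinate in
  modulus, this forces that maximum to be 0.\<close>

lemma vicsek_diagonal:
  assumes "(x, y) \<in> vicsek" "\<bar>x\<bar> = \<bar>y\<bar>"
  shows "(x, y) = (0, 0)"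
proof -
  define D where "D = vicsek \<inter> {p. \<bar>fst p\<bar> = \<bar>snd p\<bar>}"
  have xy: "(x, y) \<in> D" using assms by (simp add: D_def)
  have "closed {p :: real \<times> real. \<bar>fst p\<bar> = \<bar>snd p\<bar>}"
    by (intro closed_Collect_eq continuous_intros)
  then have "compact D" unfolding D_def using vicsek_compact by (rule compact_Int_closed[rotated])
  moreover have "continuous_on D (\<lambda>p. \<bar>fst p\<bar>)" by (intro continuous_intros)
  ultimately obtain p where p: "p \<in> D" "\<And>q. q \<in> D \<Longrightarrow> \<bar>fst q\<bar> \<le> \<bar>fst p\<bar>"
    using xy continuous_attains_sup[of D "\<lambda>p. \<bar>fst p\<bar>"] by blast
  have "p \<in> vicsek" using p(1) by (simp add: D_def)
  then obtain c q where cq: "c \<in> vicsek_centres" "q \<in> vicsek" "p = cell_map c q"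
    by (rule vicsek_cases)
  obtain u v where q: "q = (u, v)" by (cases q)
  have "\<bar>u\<bar> + \<bar>v\<bar> \<le> 3" using cq(2) q vicsek_subset_diamond by simp
  \<comment> \<open>A side cell is impossible: for the centre \<open>(2, 0)\<close>, say,
    \<open>\<bar>u + 6\<bar> = \<bar>v\<bar>\<close> would contradict
    \<open>\<bar>u\<bar> + \<bar>v\<bar> \<le> 3\<close>.\<close>
  then have pq: "p = (u / 3, v / 3)"
    using p(1) cq(1,3) by (auto simp: q D_def vicsek_centres_def cell_map_Pair)
  then have "q \<in> D" using p(1) cq(2) by (simp add: D_def q)
  then have "\<bar>fst p\<bar> = 0" using p(2)[of q] pq q by simp
  then show ?thesis using p(2)[OF xy] assms(2) by simp
qed

text \<open>The point of \<open>A\<close> farthest from the fractal is the image of a point of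
  \<open>A\<close> under a contraction that preserves the fractal, so the maximal distance is at
  most a third of itself. This applies to the cross \<open>previcsek 0\<close>, which is covered by
  its five copies without being their union.\<close>

lemma compact_subset_vicsek:
  assumes "compact A" "A \<subseteq> (\<Union>c\<in>vicsek_centres. cell_map c ` A)"
  shows "A \<subseteq> vicsek"
proof (cases "A = {}")
  case False
  note cl = compact_imp_closed[OF vicsek_compact]
  have "continuous_on A (\<lambda>x. infdist x vicsek)" by (intro continuous_intros)
  then obtain x where x: "x \<in> A" "\<And>y. y \<in> A \<Longrightarrow> infdist y vicsek \<le> infdist x vicsek"
    using continuous_attains_sup[OF assms(1) False] by blast
  then obtain c y where cy: "c \<in> vicsek_centres" "y \<in> A" "x = cell_map c y"
    using assms(2) by blast
  obtain z where z: "z \<in> vicsek" "infdist y vicsek = dist y z"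
    using infdist_attains_inf[OF cl vicsek_nonempty] by blast
  have "infdist x vicsek \<le> dist x (cell_map c z)"
    using cell_map_in_vicsek[OF cy(1) z(1)] by (rule infdist_le)
  also have "\<dots> = infdist y vicsek / 3"
    using dist_vicsek_maps[of "cell_map c" y z] cy(1,3) z(2) by (simp add: vicsek_maps_eq)
  also have "\<dots> \<le> infdist x vicsek / 3" using x(2)[OF cy(2)] by simp
  finally have "infdist x vicsek = 0" using infdist_nonneg[of x vicsek] by simp
  then have "infdist y vicsek = 0" if "y \<in> A" for y
    using x(2)[OF that] infdist_nonneg[of y vicsek] by simp
  then show ?thesis using in_closed_iff_infdist_zero[OF cl vicsek_nonempty] by auto
qed simp

section \<open>The pre-fractals as subsets of the fractal\<close>

lemma previcsek_Suc_eq: "previcsek (Suc n) = (\<Union>c\<in>vicsek_centres. cell_map c ` previcsek n)"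
  by (simp add: vicsek_maps_eq)

lemma previcsek_0_eq: "previcsek 0 = {-3..3} \<times> {0} \<union> {0} \<times> {-3..3}"
  by auto

lemma previcsek_subset_vicsek: "previcsek n \<subseteq> vicsek"
proof (induction n)
  case 0
  show ?case
  proof (rule compact_subset_vicsek)
    show "compact (previcsek 0)"
      unfolding previcsek_0_eq by (intro compact_Un compact_Times) auto
    show "previcsek 0 \<subseteq> (\<Union>c\<in>vicsek_centres. cell_map c ` previcsek 0)"
    proof
      fix p assume p: "p \<in> previcsek 0"
      obtain x y where xy: "p = (x, y)" by (cases p)
      have inv: "p = cell_map c (3 *\<^sub>R (p - c))" for c by (simp add: cell_map_def)
      \<comment> \<open>The outer third of each arm of the cross lies in the side cell on that arm,
        the middle part in the central cell.\<close>
      consider "x \<ge> 1" | "x \<le> -1" | "y \<ge> 1" | "y \<le> -1" | "\<bar>x\<bar> \<le> 1" "\<bar>y\<bar> \<le> 1" by linarith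
      then obtain c where "c \<in> vicsek_centres" "3 *\<^sub>R (p - c) \<in> previcsek 0"
      proof cases
        case 1
        show ?thesis by (rule that[of "(2, 0)"]) (use 1 p in \<open>auto simp: xy vicsek_centres_def\<close>)
      next
        case 2
        show ?thesis by (rule that[of "(-2, 0)"]) (use 2 p in \<open>auto simp: xy vicsek_centres_def\<close>)
      next
        case 3
        show ?thesis by (rule that[of "(0, 2)"]) (use 3 p in \<open>auto simp: xy vicsek_centres_def\<close>)
      next
        case 4
        show ?thesis by (rule that[of "(0, -2)"]) (use 4 p in \<open>auto simp: xy vicsek_centres_def\<close>)
      next
        case 5
        show ?thesis by (rule that[of "(0, 0)"]) (use 5 p in \<open>auto simp: xy vicsek_centres_def\<close>)
      qed
      then show "p \<in> (\<Union>c\<in>vicsek_centres. cell_map c ` previcsek 0)"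
        using inv by blast
    qed
  qed
next
  case (Suc n)
  then show ?case unfolding previcsek_Suc_eq using cell_map_in_vicsek by blast
qed

section \<open>The points where cells touch\<close>

definition vicsek_tips :: "(real \<times> real) set" where
  "vicsek_tips = {(3, 0), (0, 3), (-3, 0), (0, -3)}"

text \<open>Each tip \<open>e\<close> is the fixed point of the contraction with centre
  \<open>(2/3) *\<^sub>R e\<close>, so it survives every iteration.\<close>

lemma vicsek_tips_subset_previcsek: "vicsek_tips \<subseteq> previcsek n"
proof (induction n)
  case 0
  show ?case by (auto simp: vicsek_tips_def)
next
  case (Suc n)
  have "e \<in> previcsek (Suc n)" if "e \<in> vicsek_tips" for e
  proof -
    have "(2/3) *\<^sub>R e \<in> vicsek_centres" "cell_map ((2/3) *\<^sub>R e) e = e"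
      using that by (auto simp: vicsek_tips_def vicsek_centres_def cell_map_def)
    moreover have "e \<in> previcsek n" using that Suc by auto
    ultimately show ?thesis unfolding previcsek_Suc_eq by (metis UN_I imageI)
  qed
  then show ?case by blast
qed

text \<open>A common point means \<open>p - q = 3 *\<^sub>R (c' - c)\<close>, whose 1-norm is at
  most 6 by the diamond bound. Two side centres would give 12, which is impossible. The origin and a
  side centre give exactly 6, and equality forces \<open>p\<close> and \<open>q\<close> to be
  opposite tips.\<close>

lemma cells_meet:
  assumes "c \<in> vicsek_centres" "c' \<in> vicsek_centres" "c \<noteq> c'" "p \<in> vicsek" "q \<in> vicsek"
    and "cell_map c p = cell_map c' q"
  shows "p \<in> vicsek_tips \<and> q \<in> vicsek_tips \<and> (c = (0, 0) \<and> c' = (2/3) *\<^sub>R p \<or> c' = (0, 0) \<and> c = (2/3) *\<^sub>R q)"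
proof -
  obtain x y u v where pq: "p = (x, y)" "q = (u, v)" by (cases p, cases q)
  have n: "\<bar>x\<bar> + \<bar>y\<bar> \<le> 3" "\<bar>u\<bar> + \<bar>v\<bar> \<le> 3" using assms(4,5) pq vicsek_subset_diamond by auto
  have tips: "x - u = 6 \<Longrightarrow> p = (3, 0) \<and> q = (-3, 0)" "x - u = -6 \<Longrightarrow> p = (-3, 0) \<and> q = (3, 0)"
      "y - v = 6 \<Longrightarrow> p = (0, 3) \<and> q = (0, -3)" "y - v = -6 \<Longrightarrow> p = (0, -3) \<and> q = (0, 3)"
    using n by (simp add: pq; linarith)+
  have far: "\<bar>x - u\<bar> + \<bar>y - v\<bar> \<le> 6" using n by linarith
  have d: "x - u = 3 * (fst c' - fst c)" "y - v = 3 * (snd c' - snd c)"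
    using assms(6) by (cases c; cases c'; simp add: pq cell_map_Pair)+
  consider "c = (0, 0)" | "c' = (0, 0)" | "c \<noteq> (0, 0)" "c' \<noteq> (0, 0)" by blast
  then show ?thesis
  proof cases
    case 1
    then show ?thesis using assms(2,3) d tips by (auto simp: vicsek_centres_def vicsek_tips_def)
  next
    case 2
    then show ?thesis using assms(1,3) d tips by (auto simp: vicsek_centres_def vicsek_tips_def)
  next
    case 3
    then have False using assms(1,2,3) far unfolding d by (auto simp: vicsek_centres_def)
    then show ?thesis ..
  qed
qed

section \<open>The retraction onto a pre-fractal\<close>

text \<open>Each point is projected to the axis of its larger coordinate. The two double cones cut
  the fractal into pieces that share only the origin, and on each piece the map is an orthogonal
  projection.\<close>

lemma retraction_previcsek_0:
  "\<exists>r. length_contracting vicsek r \<and> r ` vicsek \<subseteq> previcsek 0 \<and> (\<forall>p\<in>previcsek 0. r p = p)"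
proof -
  define r :: "real \<times> real \<Rightarrow> real \<times> real" where
    "r = (\<lambda>(x, y). if \<bar>y\<bar> \<le> \<bar>x\<bar> then (x, 0) else (0, y))"
  define A where "A = vicsek \<inter> {p. \<bar>snd p\<bar> \<le> \<bar>fst p\<bar>}"
  define B where "B = vicsek \<inter> {p. \<bar>fst p\<bar> \<le> \<bar>snd p\<bar>}"
  note cl = compact_imp_closed[OF vicsek_compact]
  have "length_contracting A (\<lambda>p. (fst p, 0))"
    by (rule length_contracting_1_Lipschitz) (simp add: dist_Pair_Pair dist_fst_le)
  then have A: "length_contracting A r"
    by (rule length_contracting_cong) (auto simp: A_def r_def)
  have "length_contracting B (\<lambda>p. (0, snd p))"
    by (rule length_contracting_1_Lipschitz) (simp add: dist_Pair_Pair dist_snd_le)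
  then have B: "length_contracting B r"
  proof (rule length_contracting_cong)
    \<comment> \<open>In a tie \<open>r\<close> projects to the horizontal axis, but within the
      fractal a tie occurs only at the origin, where both projections agree.\<close>
    fix p assume p: "p \<in> B"
    then show "(0, snd p) = r p"
      using vicsek_diagonal[of "fst p" "snd p"] by (cases p) (auto simp: B_def r_def)
  qed
  have "(0, 0) \<in> vicsek" using previcsek_subset_vicsek[of 0] by auto
  then have "A \<inter> B = {(0, 0)}" using vicsek_diagonal by (force simp: A_def B_def)
  then have "length_contracting (A \<union> B) r"
    by (intro length_contracting_Un A B)
      (auto simp: A_def B_def intro!: closed_Int cl closed_Collect_le continuous_intros)
  moreover have "A \<union> B = vicsek" by (auto simp: A_def B_def)
  moreover have "r ` vicsek \<subseteq> previcsek 0"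
    using vicsek_subset_diamond by (force simp: r_def)
  moreover have "\<forall>p\<in>previcsek 0. r p = p" by (auto simp: r_def)
  ultimately show ?thesis by auto
qed

section \<open>Gluing over the five cells\<close>

lemma closed_cell: "closed (cell_map c ` vicsek)"
  unfolding cell_map_def
  by (intro compact_imp_closed compact_continuous_image vicsek_compact continuous_intros)

text \<open>The side cells are attached one at a time to the central cell. They are pairwise
  disjoint and each touches the central cell in one point, so every union has the one-point overlap
  that \<open>length_contracting_Un\<close> asks for.\<close>

lemma length_contracting_vicsek_cells:
  assumes "\<And>c. c \<in> vicsek_centres \<Longrightarrow> length_contracting (cell_map c ` vicsek) f"
  shows "length_contracting vicsek f"
proof -
  let ?V = "\<lambda>u v. cell_map (u, v) ` vicsek"
  have tips: "vicsek_tips \<subseteq> vicsek"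
    using vicsek_tips_subset_previcsek previcsek_subset_vicsek by blast
  have meet: "?V 0 0 \<inter> cell_map ((2/3) *\<^sub>R e) ` vicsek = {cell_map (0, 0) e}"
    if e: "e \<in> vicsek_tips" for e
  proof -
    have c: "(2/3) *\<^sub>R e \<in> vicsek_centres" "(2/3) *\<^sub>R e \<noteq> (0, 0)"
      using e by (auto simp: vicsek_tips_def vicsek_centres_def)
    \<comment> \<open>The tip \<open>e\<close> of the central cell coincides with the opposite tip
      of the neighbouring cell.\<close>
    have "cell_map (0, 0) e = cell_map ((2/3) *\<^sub>R e) (- e)" "- e \<in> vicsek_tips"
      using e by (auto simp: vicsek_tips_def cell_map_Pair)
    then have "cell_map (0, 0) e \<in> cell_map ((2/3) *\<^sub>R e) ` vicsek"
      using tips by (intro image_eqI) auto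
    moreover have "cell_map (0, 0) e \<in> ?V 0 0" using tips e by blast
    moreover have "x = cell_map (0, 0) e" if x: "x \<in> ?V 0 0" "x \<in> cell_map ((2/3) *\<^sub>R e) ` vicsek" for x
    proof -
      obtain p q where pq: "p \<in> vicsek" "q \<in> vicsek" "x = cell_map (0, 0) p"
        "x = cell_map ((2/3) *\<^sub>R e) q" using x by blast
      have "(0, 0) \<in> vicsek_centres" by (simp add: vicsek_centres_def)
      from cells_meet[OF this c(1) c(2)[symmetric] pq(1,2) trans[OF pq(3)[symmetric] pq(4)]]
      have "(2/3) *\<^sub>R e = (2/3) *\<^sub>R p" using c(2) by blast
      then have "p = e" by simp
      then show ?thesis using pq by simp
    qed
    ultimately show ?thesis by blast
  qed
  have disj: "cell_map c ` vicsek \<inter> cell_map c' ` vicsek = {}"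
    if "c \<in> vicsek_centres" "c' \<in> vicsek_centres" "c \<noteq> c'" "c \<noteq> (0, 0)" "c' \<noteq> (0, 0)" for c c'
    using cells_meet[OF that(1-3)] that(4,5) by blast
  have m: "?V 0 0 \<inter> ?V 2 0 = {(1, 0)}" "?V 0 0 \<inter> ?V 0 2 = {(0, 1)}"
      "?V 0 0 \<inter> ?V (-2) 0 = {(-1, 0)}" "?V 0 0 \<inter> ?V 0 (-2) = {(0, -1)}"
    using meet[of "(3, 0)"] meet[of "(0, 3)"] meet[of "(-3, 0)"] meet[of "(0, -3)"]
    by (simp_all add: vicsek_tips_def cell_map_Pair)
  have d: "?V 2 0 \<inter> ?V 0 2 = {}" "?V 2 0 \<inter> ?V (-2) 0 = {}" "?V 0 2 \<inter> ?V (-2) 0 = {}"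
      "?V 2 0 \<inter> ?V 0 (-2) = {}" "?V 0 2 \<inter> ?V 0 (-2) = {}" "?V (-2) 0 \<inter> ?V 0 (-2) = {}"
    by (rule disj; simp add: vicsek_centres_def)+
  have f: "length_contracting (?V 0 0) f" "length_contracting (?V 2 0) f"
      "length_contracting (?V 0 2) f" "length_contracting (?V (-2) 0) f" "length_contracting (?V 0 (-2)) f"
    by (rule assms; simp add: vicsek_centres_def)+
  have "length_contracting (?V 0 0 \<union> ?V 2 0) f"
    by (rule length_contracting_Un[OF closed_cell f(1) closed_cell f(2) m(1)])
  moreover have "(?V 0 0 \<union> ?V 2 0) \<inter> ?V 0 2 = {(0, 1)}"
    by (simp only: Int_Un_distrib2 m d Un_empty_right)
  ultimately have "length_contracting (?V 0 0 \<union> ?V 2 0 \<union> ?V 0 2) f"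
    by (intro length_contracting_Un[OF _ _ closed_cell f(3)] closed_Un closed_cell)
  moreover have "(?V 0 0 \<union> ?V 2 0 \<union> ?V 0 2) \<inter> ?V (-2) 0 = {(-1, 0)}"
    by (simp only: Int_Un_distrib2 m d Un_empty_right)
  ultimately have "length_contracting (?V 0 0 \<union> ?V 2 0 \<union> ?V 0 2 \<union> ?V (-2) 0) f"
    by (intro length_contracting_Un[OF _ _ closed_cell f(4)] closed_Un closed_cell)
  moreover have "(?V 0 0 \<union> ?V 2 0 \<union> ?V 0 2 \<union> ?V (-2) 0) \<inter> ?V 0 (-2) = {(0, -1)}"
    by (simp only: Int_Un_distrib2 m d Un_empty_right)
  ultimately have "length_contracting (?V 0 0 \<union> ?V 2 0 \<union> ?V 0 2 \<union> ?V (-2) 0 \<union> ?V 0 (-2)) f"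
    by (intro length_contracting_Un[OF _ _ closed_cell f(5)] closed_Un closed_cell)
  moreover have "vicsek = ?V 0 0 \<union> ?V 2 0 \<union> ?V 0 2 \<union> ?V (-2) 0 \<union> ?V 0 (-2)"
    by (subst vicsek_eq) (simp add: vicsek_centres_def Un_assoc)
  ultimately show ?thesis by simp
qed

text \<open>Induction on \<open>n\<close>: the retraction for \<open>n\<close> is copied into each
  cell. The copies agree where cells touch, since such points come from tips, and tips belong to
  every pre-fractal and are therefore fixed.\<close>

lemma retraction_previcsek:
  "\<exists>r. length_contracting vicsek r \<and> r ` vicsek \<subseteq> previcsek n \<and> (\<forall>p\<in>previcsek n. r p = p)"
proof (induction n)
  case 0
  show ?case by (rule retraction_previcsek_0)
next
  case (Suc n)
  then obtain r where r: "length_contracting vicsek r" "r ` vicsek \<subseteq> previcsek n"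
      "\<And>p. p \<in> previcsek n \<Longrightarrow> r p = p" by blast
  \<comment> \<open>A touching point is represented in two cells, so the new map is first a
    relation; \<open>r'\<close> chooses a value, and independence of the cell is shown
    afterwards.\<close>
  define P where "P p x \<longleftrightarrow> (\<exists>c\<in>vicsek_centres. \<exists>q\<in>vicsek. p = cell_map c q \<and> x = cell_map c (r q))" for p x
  define r' where "r' p = (SOME x. P p x)" for p
  have tips: "r e = e" if "e \<in> vicsek_tips" for e
    using that r(3) vicsek_tips_subset_previcsek by blast
  have r': "r' (cell_map c q) = cell_map c (r q)" if cq: "c \<in> vicsek_centres" "q \<in> vicsek" for c q
  proof -
    have "P (cell_map c q) (cell_map c (r q))" using cq by (auto simp: P_def)
    then have "P (cell_map c q) (r' (cell_map c q))" unfolding r'_def by (rule someI)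
    then obtain c' q' where *: "c' \<in> vicsek_centres" "q' \<in> vicsek"
        "cell_map c q = cell_map c' q'" "r' (cell_map c q) = cell_map c' (r q')"
      by (auto simp: P_def)
    show ?thesis
    proof (cases "c = c'")
      case True
      then have "q = q'" using *(3) by (simp add: cell_map_def)
      then show ?thesis using True *(4) by simp
    next
      case False
      \<comment> \<open>Here \<open>q\<close> and \<open>q'\<close> are tips, so \<open>r\<close>
        fixes both and either cell returns the common point itself.\<close>
      then show ?thesis using cells_meet[OF cq(1) *(1) False cq(2) *(2,3)] * tips by simp
    qed
  qed
  have "length_contracting vicsek r'"
  proof (rule length_contracting_vicsek_cells)
    fix c assume "c \<in> vicsek_centres"
    then show "length_contracting (cell_map c ` vicsek) r'"
      using r' by (intro length_contracting_conjugate[OF r(1), of "1/3" _ c]) (auto simp: cell_map_def)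
  qed
  moreover have "r' ` vicsek \<subseteq> previcsek (Suc n)"
  proof
    fix x assume "x \<in> r' ` vicsek"
    then obtain p where p: "p \<in> vicsek" "x = r' p" by auto
    obtain c q where cq: "c \<in> vicsek_centres" "q \<in> vicsek" "p = cell_map c q" using vicsek_cases[OF p(1)] .
    then have "x = cell_map c (r q)" "r q \<in> previcsek n" using p(2) r' r(2) by blast+
    then show "x \<in> previcsek (Suc n)" unfolding previcsek_Suc_eq using cq(1) by blast
  qed
  moreover have "r' p = p" if p: "p \<in> previcsek (Suc n)" for p
  proof -
    obtain c q where cq: "c \<in> vicsek_centres" "q \<in> previcsek n" "p = cell_map c q"
      using p unfolding previcsek_Suc_eq by blast
    then have "q \<in> vicsek" using previcsek_subset_vicsek by blast
    then show ?thesis using cq r' r(3) by simp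
  qed
  ultimately show ?case by blast
qed

section \<open>Agreement of the intrinsic metrics, and convergence\<close>

lemma intrinsic_dist_previcsek:
  assumes "p \<in> previcsek n" "q \<in> previcsek n"
  shows "intrinsic_dist (previcsek n) p q = intrinsic_dist vicsek p q"
proof -
  obtain r where r: "length_contracting vicsek r" "r ` vicsek \<subseteq> previcsek n"
      "\<forall>p\<in>previcsek n. r p = p" using retraction_previcsek by blast
  then show ?thesis using assms by (intro intrinsic_dist_retract[OF r(1,2) previcsek_subset_vicsek]) auto
qed

text \<open>Two triangle inequalities in each direction enclose the distance between
  \<open>L - e n\<close> and \<open>L + e n\<close>, where \<open>e n\<close> tends to 0. The
  argument also covers an infinite \<open>L\<close>.\<close>

lemma tendsto_intrinsic_dist:
  fixes p q :: "'a::real_normed_vector"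
  assumes "((\<lambda>n. intrinsic_dist S (ps n) p) \<longlongrightarrow> 0) F" "((\<lambda>n. intrinsic_dist S (qs n) q) \<longlongrightarrow> 0) F"
  shows "((\<lambda>n. intrinsic_dist S (ps n) (qs n)) \<longlongrightarrow> intrinsic_dist S p q) F"
proof -
  define e where "e n = intrinsic_dist S (ps n) p + intrinsic_dist S (qs n) q" for n
  define L where "L = intrinsic_dist S p q"
  have e0: "(e \<longlongrightarrow> 0) F" using tendsto_add[OF assms] by (simp add: e_def[abs_def])
  have up: "intrinsic_dist S (ps n) (qs n) \<le> L + e n" for n
  proof -
    have "intrinsic_dist S (ps n) (qs n) \<le> intrinsic_dist S (ps n) p + intrinsic_dist S p (qs n)"
      by (rule intrinsic_dist_triangle)
    also have "\<dots> \<le> intrinsic_dist S (ps n) p + (L + intrinsic_dist S q (qs n))"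
      unfolding L_def by (intro add_left_mono intrinsic_dist_triangle)
    finally show ?thesis by (simp add: e_def intrinsic_dist_commute[of S q] ac_simps)
  qed
  \<comment> \<open>In \<open>ennreal\<close>, \<open>top - top\<close> is \<open>top\<close>;
    finiteness of \<open>e n\<close> excludes this case when the inequality is rearranged into a
    difference. It holds eventually because \<open>e\<close> tends to 0.\<close>
  have lo: "L - e n \<le> intrinsic_dist S (ps n) (qs n)" if "e n < top" for n
  proof -
    have "L \<le> intrinsic_dist S p (ps n) + intrinsic_dist S (ps n) q"
      unfolding L_def by (rule intrinsic_dist_triangle)
    also have "\<dots> \<le> intrinsic_dist S p (ps n) + (intrinsic_dist S (ps n) (qs n) + intrinsic_dist S (qs n) q)"
      by (intro add_left_mono intrinsic_dist_triangle)
    finally have "L \<le> e n + intrinsic_dist S (ps n) (qs n)"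
      by (simp add: e_def intrinsic_dist_commute[of S p] ac_simps)
    then show ?thesis using that by (auto simp: ennreal_minus_le_iff)
  qed
  have "\<forall>\<^sub>F n in F. e n < top" using order_tendstoD(2)[OF e0, of top] by simp
  then have lo': "\<forall>\<^sub>F n in F. L - e n \<le> intrinsic_dist S (ps n) (qs n)"
    by (rule eventually_mono) (rule lo)
  have "((\<lambda>n. L + e n) \<longlongrightarrow> L) F" using tendsto_add[OF tendsto_const e0, of L] by simp
  moreover have "((\<lambda>n. L - e n) \<longlongrightarrow> L) F"
    using tendsto_diff_ennreal_general[OF tendsto_const e0, of L] by simp
  ultimately show ?thesis unfolding L_def[symmetric]
    by (rule tendsto_sandwich[OF lo' always_eventually[OF allI[OF up]], rotated])
qed

theorem theorem4p1:
  fixes a b :: "real \<times> real" and as bs :: "nat \<Rightarrow> real \<times> real"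
  assumes "a \<in> vicsek" and "b \<in> vicsek"
    and "\<And>n. as n \<in> previcsek n" and "\<And>n. bs n \<in> previcsek n"
    and "(\<lambda>n. intrinsic_dist vicsek (as n) a) \<longlonglongrightarrow> 0"
    and "(\<lambda>n. intrinsic_dist vicsek (bs n) b) \<longlonglongrightarrow> 0"
  shows "(\<lambda>n. intrinsic_dist (previcsek n) (as n) (bs n)) \<longlonglongrightarrow> intrinsic_dist vicsek a b"
  using tendsto_intrinsic_dist[OF assms(5,6)] by (simp add: intrinsic_dist_previcsek assms(3,4))

end
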